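(* Let $n\ge 2$, $m\ge 1$, let $(G,\cdot)$ be a group, let $\theta\in Aut(G,\cdot)$ and $b\in G$ satisfy $\theta(b)=b$ and $\theta^{n-1}(x)=bxb^{-1}$ for all $x\in G$, and let $(G,f)=der_{\theta,b}(G,\cdot)$. If $\Lambda:G\to GL_m(\mathbb{C})$ is a representation of $(G,f)$, then $\Lambda=R_A\Gamma$ for some $A\in GL_m(\mathbb{C})$ and some ordinary representation (group homomorphism) $\Gamma:(G,\cdot)\to GL_m(\mathbb{C})$ satisfying $$A^{n-1}=\Gamma(b)\quad\text{and}\quad \Gamma\theta=I_A^{-1}\Gamma.$$ Conversely, if $A\in GL_m(\mathbb{C})$ and an ordinary representation $\Gamma:(G,\cdot)\to GL_m(\mathbb{C})$ satisfy these two conditions, then $R_A\Gamma$ is a representation of $(G,f)$.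
   Context: $der_{\theta,b}(G,\cdot)$ is the $n$-ary group $(G,f)$ with $f(x_1,\ldots,x_n)=x_1\theta(x_2)\theta^2(x_3)\cdots\theta^{n-1}(x_n)b$. A representation of the $n$-ary group $(G,f)$ of degree $m$ is a map $\Lambda:G\to GL_m(\mathbb{C})$ with $\Lambda(f(x_1,\ldots,x_n))=\Lambda(x_1)\Lambda(x_2)\cdots\Lambda(x_n)$ for all $x_1,\ldots,x_n\in G$. For $A\in GL_m(\mathbb{C})$, $R_A(X)=XA$ and $I_A(X)=A^{-1}XA$, so $I_A^{-1}(X)=AXA^{-1}$. Products of maps are compositions, so $(R_A\Gamma)(x)=\Gamma(x)A$. *)

theory Defs
  imports "HOL-Algebra.Group" "Jordan_Normal_Form.Matrix"
begin

definition GL :: "nat \<Rightarrow> complex mat monoid" where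
  "GL m = units_of (ring_mat TYPE(complex) m ())"

definition list_prod :: "('a, 'e) monoid_scheme \<Rightarrow> 'a list \<Rightarrow> 'a" where
  "list_prod H xs = foldr (\<otimes>\<^bsub>H\<^esub>) xs \<one>\<^bsub>H\<^esub>"

text \<open>An \<open>n\<close>-ary operation takes lists of length \<open>n\<close>. Lists are indexed from \<open>0\<close>, so the
  entry \<open>xs ! i\<close> stands for the argument with number \<open>i + 1\<close>.\<close>

definition der :: "nat \<Rightarrow> ('a, 'e) monoid_scheme \<Rightarrow> ('a \<Rightarrow> 'a) \<Rightarrow> 'a \<Rightarrow> 'a list \<Rightarrow> 'a" where
  "der n G \<theta> b xs = list_prod G (map (\<lambda>i. (\<theta> ^^ i) (xs ! i)) [0..<n]) \<otimes>\<^bsub>G\<^esub> b"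

definition nary_representation ::
  "nat \<Rightarrow> 'a set \<Rightarrow> ('a list \<Rightarrow> 'a) \<Rightarrow> nat \<Rightarrow> ('a \<Rightarrow> complex mat) \<Rightarrow> bool" where
  "nary_representation n S f m \<Lambda> \<longleftrightarrow>
     \<Lambda> \<in> S \<rightarrow> carrier (GL m) \<and>
     (\<forall>xs. length xs = n \<and> set xs \<subseteq> S \<longrightarrow> \<Lambda> (f xs) = list_prod (GL m) (map \<Lambda> xs))"

definition R_map :: "nat \<Rightarrow> complex mat \<Rightarrow> complex mat \<Rightarrow> complex mat" where
  "R_map m A X = X \<otimes>\<^bsub>GL m\<^esub> A"

definition I_map :: "nat \<Rightarrow> complex mat \<Rightarrow> complex mat \<Rightarrow> complex mat" where
  "I_map m A X = inv\<^bsub>GL m\<^esub> A \<otimes>\<^bsub>GL m\<^esub> X \<otimes>\<^bsub>GL m\<^esub> A"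

definition I_inv_map :: "nat \<Rightarrow> complex mat \<Rightarrow> complex mat \<Rightarrow> complex mat" where
  "I_inv_map m A X = A \<otimes>\<^bsub>GL m\<^esub> X \<otimes>\<^bsub>GL m\<^esub> inv\<^bsub>GL m\<^esub> A"

lemma carrier_GL: "carrier (GL m) = {A \<in> carrier_mat m m. invertible_mat A}"
proof -
  have "invertible_mat A \<longleftrightarrow> (\<exists>B \<in> carrier_mat m m. B * A = 1\<^sub>m m \<and> A * B = 1\<^sub>m m)"
    if A: "A \<in> carrier_mat m m" for A :: "complex mat"
  proof
    assume "invertible_mat A"
    then obtain B where B: "A * B = 1\<^sub>m (dim_row A)" "B * A = 1\<^sub>m (dim_row B)"
      unfolding invertible_mat_def inverts_mat_def by blast
    have "dim_col B = m" using arg_cong[OF B(1), of dim_col] A by simp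
    moreover have "dim_row B = m" using arg_cong[OF B(2), of dim_col] A by simp
    ultimately show "\<exists>B \<in> carrier_mat m m. B * A = 1\<^sub>m m \<and> A * B = 1\<^sub>m m"
      using A B by (intro bexI[of _ B]) auto
  next
    assume "\<exists>B \<in> carrier_mat m m. B * A = 1\<^sub>m m \<and> A * B = 1\<^sub>m m"
    then show "invertible_mat A"
      using A unfolding invertible_mat_def inverts_mat_def by (auto simp: square_mat.simps)
  qed
  then show ?thesis
    by (auto simp: GL_def units_of_def Units_def ring_mat_simps)
qed

lemma group_GL: "group (GL m)"
  unfolding GL_def
  by (intro monoid.units_group ring.axioms(2) ring_mat)

lemma I_inv_map_inverse:
  assumes "A \<in> carrier (GL m)" "X \<in> carrier (GL m)"
  shows "I_map m A (I_inv_map m A X) = X" and "I_inv_map m A (I_map m A X) = X"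
proof -
  interpret group "GL m" by (rule group_GL)
  show "I_map m A (I_inv_map m A X) = X" "I_inv_map m A (I_map m A X) = X"
    using assms by (simp_all add: I_map_def I_inv_map_def m_assoc inv_solve_left)
      (simp_all add: m_assoc[symmetric])
qed

end

theory Submission
  imports Defs
begin

text \<open>Put \<open>A = \<Lambda> \<one>\<close>. Evaluating \<open>\<Lambda>\<close> on \<open>f (x, \<one>, \<dots>, \<one>, y) = x b y\<close> gives
  \<open>\<Lambda> (x b y) = \<Lambda> x A\<^sup>n\<^sup>-\<^sup>2 \<Lambda> y\<close>, whence \<open>\<Lambda> (x y) = \<Lambda> x A\<^sup>-\<^sup>1 \<Lambda> y\<close>. So \<open>\<Gamma> x = \<Lambda> x A\<^sup>-\<^sup>1\<close> is a
  homomorphism; the case \<open>x = y = \<one>\<close> gives \<open>\<Gamma> b = A\<^sup>n\<^sup>-\<^sup>1\<close>, and evaluating \<open>\<Lambda>\<close> on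
  \<open>f (\<one>, x, \<one>, \<dots>, \<one>) = \<theta> x b\<close> gives \<open>\<Gamma> (\<theta> x) = A \<Gamma> x A\<^sup>-\<^sup>1\<close>. The converse moves all factors \<open>A\<close>
  in \<open>\<Gamma> x\<^sub>1 A \<dots> \<Gamma> x\<^sub>n A\<close> to the right. Nothing depends on the target group being \<open>GL m\<close>.\<close>

lemma (in monoid) list_prod_closed:
  "set xs \<subseteq> carrier G \<Longrightarrow> list_prod G xs \<in> carrier G"
  by (induction xs) (auto simp: list_prod_def)

lemma (in monoid) list_prod_snoc:
  "set xs \<subseteq> carrier G \<Longrightarrow> y \<in> carrier G \<Longrightarrow> list_prod G (xs @ [y]) = list_prod G xs \<otimes> y"
proof (induction xs)
  case (Cons a xs)
  then show ?case
    using list_prod_closed[of xs] by (simp add: list_prod_def m_assoc)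
qed (simp add: list_prod_def)

text \<open>For evaluating a representation at tuples padded with the identity: the padding is
  mapped to a block of equal factors, which becomes a power.\<close>

lemma (in monoid) list_prod_append_replicate:
  assumes "set xs \<subseteq> carrier G" "y \<in> carrier G"
  shows "list_prod G (xs @ replicate k y) = list_prod G xs \<otimes> y [^] k"
proof (induction k)
  case 0
  then show ?case using assms by (simp add: list_prod_closed)
next
  case (Suc k)
  have "list_prod G ((xs @ replicate k y) @ [y]) = list_prod G (xs @ replicate k y) \<otimes> y"
    using assms by (intro list_prod_snoc) auto
  also have "\<dots> = list_prod G xs \<otimes> y [^] Suc k"
    using assms Suc by (simp add: list_prod_closed m_assoc)
  finally show ?case by (simp add: replicate_append_same)
qed

text \<open>The operation \<open>der\<close> without its final factor \<open>b\<close>. The arity is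
  read off from the list, so that induction on the list is possible.\<close>

definition twisted_prod :: "('a, 'e) monoid_scheme \<Rightarrow> ('a \<Rightarrow> 'a) \<Rightarrow> 'a list \<Rightarrow> 'a" where
  "twisted_prod G \<theta> xs = list_prod G (map (\<lambda>i. (\<theta> ^^ i) (xs ! i)) [0..<length xs])"

lemma der_eq_twisted_prod:
  "length xs = n \<Longrightarrow> der n G \<theta> b xs = twisted_prod G \<theta> xs \<otimes>\<^bsub>G\<^esub> b"
  by (simp add: der_def twisted_prod_def)

lemma funpow_closed:
  "\<theta> \<in> S \<rightarrow> S \<Longrightarrow> x \<in> S \<Longrightarrow> (\<theta> ^^ i) x \<in> S"
  by (induction i) auto

lemma (in group) funpow_hom_one:
  "\<theta> \<in> hom G G \<Longrightarrow> (\<theta> ^^ i) \<one> = \<one>"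
  by (induction i) (auto simp: hom_one[OF _ is_group is_group])

lemma (in monoid) twisted_factors_closed:
  assumes "\<theta> \<in> carrier G \<rightarrow> carrier G" "set xs \<subseteq> carrier G"
  shows "set (map (\<lambda>i. (\<theta> ^^ i) (xs ! i)) [0..<length xs]) \<subseteq> carrier G"
  using assms by (auto intro!: funpow_closed)

lemma (in monoid) twisted_prod_closed:
  assumes "\<theta> \<in> carrier G \<rightarrow> carrier G" "set xs \<subseteq> carrier G"
  shows "twisted_prod G \<theta> xs \<in> carrier G"
  unfolding twisted_prod_def using assms by (intro list_prod_closed twisted_factors_closed)

text \<open>Appending at the end leaves the exponents of \<theta> at earlier positions unchanged,
  whereas prepending would raise each of them by one. Inductions therefore peel off the last
  entry.\<close>

lemma (in monoid) twisted_prod_snoc: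
  assumes "\<theta> \<in> carrier G \<rightarrow> carrier G" "set xs \<subseteq> carrier G" "y \<in> carrier G"
  shows "twisted_prod G \<theta> (xs @ [y]) = twisted_prod G \<theta> xs \<otimes> (\<theta> ^^ length xs) y"
proof -
  have "map (\<lambda>i. (\<theta> ^^ i) ((xs @ [y]) ! i)) [0..<length (xs @ [y])] =
      map (\<lambda>i. (\<theta> ^^ i) (xs ! i)) [0..<length xs] @ [(\<theta> ^^ length xs) y]"
    by (simp add: nth_append)
  then show ?thesis
    unfolding twisted_prod_def
    by (simp only: list_prod_snoc[OF twisted_factors_closed[OF assms(1,2)] funpow_closed[OF assms(1,3)]])
qed

text \<open>All powers of \<theta> fix the identity. This collapses the padded tuples at which
  \<Lambda> is evaluated below.\<close>

lemma (in group) twisted_prod_append_ones: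
  assumes "\<theta> \<in> hom G G" "set xs \<subseteq> carrier G"
  shows "twisted_prod G \<theta> (xs @ replicate k \<one>) = twisted_prod G \<theta> xs"
proof (induction k)
  case (Suc k)
  have \<theta>: "\<theta> \<in> carrier G \<rightarrow> carrier G"
    using assms(1) by (auto simp: hom_def)
  have "twisted_prod G \<theta> ((xs @ replicate k \<one>) @ [\<one>]) =
      twisted_prod G \<theta> (xs @ replicate k \<one>) \<otimes> (\<theta> ^^ length (xs @ replicate k \<one>)) \<one>"
    using assms by (intro twisted_prod_snoc[OF \<theta>]) auto
  also have "\<dots> = twisted_prod G \<theta> xs"
    using Suc twisted_prod_closed[OF \<theta> assms(2)] funpow_hom_one[OF assms(1)] by simp
  finally show ?case by (simp add: replicate_append_same)
qed simp

text \<open>By \<open>tw\<close>, A \<Gamma>(x) = \<Gamma>(\<theta> x) A. The argument at index i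
  has i factors A on its left, so moving these to the right applies \<theta> to it i times. Leaving
  \<open>b\<close> out keeps the statement valid for every length.\<close>

lemma (in group) list_prod_twisted_hom:
  assumes H: "group H" and \<theta>: "\<theta> \<in> carrier G \<rightarrow> carrier G" and \<Gamma>: "\<Gamma> \<in> hom G H"
    and A: "A \<in> carrier H"
    and tw: "\<And>x. x \<in> carrier G \<Longrightarrow> \<Gamma> (\<theta> x) = A \<otimes>\<^bsub>H\<^esub> \<Gamma> x \<otimes>\<^bsub>H\<^esub> inv\<^bsub>H\<^esub> A"
    and xs: "set xs \<subseteq> carrier G"
  shows "list_prod H (map (\<lambda>x. \<Gamma> x \<otimes>\<^bsub>H\<^esub> A) xs) =
    \<Gamma> (twisted_prod G \<theta> xs) \<otimes>\<^bsub>H\<^esub> A [^]\<^bsub>H\<^esub> length xs"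
proof -
  interpret H: group H by (rule H)
  have \<Gamma>_closed: "\<Gamma> x \<in> carrier H" if "x \<in> carrier G" for x
    using \<Gamma> that by (auto simp: hom_def)
  have shift: "\<Gamma> ((\<theta> ^^ k) x) \<otimes>\<^bsub>H\<^esub> A [^]\<^bsub>H\<^esub> k = A [^]\<^bsub>H\<^esub> k \<otimes>\<^bsub>H\<^esub> \<Gamma> x"
    if x: "x \<in> carrier G" for x and k :: nat
  proof (induction k)
    case (Suc k)
    let ?y = "(\<theta> ^^ k) x"
    have y: "\<Gamma> ?y \<in> carrier H" "?y \<in> carrier G"
      using funpow_closed[OF \<theta> x] \<Gamma>_closed by auto
    \<comment> \<open>\<open>nat_pow_Suc2\<close> splits off A on the left of the power, next to the
      \<open>inv A\<close> produced by \<open>tw\<close>, so that the two cancel.\<close>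
    have "\<Gamma> ((\<theta> ^^ Suc k) x) \<otimes>\<^bsub>H\<^esub> A [^]\<^bsub>H\<^esub> Suc k =
        A \<otimes>\<^bsub>H\<^esub> \<Gamma> ?y \<otimes>\<^bsub>H\<^esub> (inv\<^bsub>H\<^esub> A \<otimes>\<^bsub>H\<^esub> (A \<otimes>\<^bsub>H\<^esub> A [^]\<^bsub>H\<^esub> k))"
      unfolding H.nat_pow_Suc2[OF A] using y A tw by (simp add: H.m_assoc)
    also have "\<dots> = A \<otimes>\<^bsub>H\<^esub> (\<Gamma> ?y \<otimes>\<^bsub>H\<^esub> A [^]\<^bsub>H\<^esub> k)"
      using y A by (simp add: H.m_assoc flip: H.m_assoc[of "inv\<^bsub>H\<^esub> A" A])
    also have "\<dots> = A [^]\<^bsub>H\<^esub> Suc k \<otimes>\<^bsub>H\<^esub> \<Gamma> x"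
      unfolding Suc H.nat_pow_Suc2[OF A] using A \<Gamma>_closed[OF x] by (simp add: H.m_assoc)
    finally show ?case .
  qed (use x \<Gamma>_closed in simp)
  show ?thesis
    using xs
  proof (induction xs rule: rev_induct)
    case Nil
    then show ?case
      using hom_one[OF \<Gamma> is_group H] by (simp add: twisted_prod_def list_prod_def)
  next
    case (snoc x xs)
    let ?P = "twisted_prod G \<theta> xs" and ?k = "length xs"
    have cl: "x \<in> carrier G" "?P \<in> carrier G" "(\<theta> ^^ ?k) x \<in> carrier G"
      using snoc.prems twisted_prod_closed[OF \<theta>] funpow_closed[OF \<theta>] by auto
    note cls = cl[THEN \<Gamma>_closed] A
    have "list_prod H (map (\<lambda>x. \<Gamma> x \<otimes>\<^bsub>H\<^esub> A) xs @ [\<Gamma> x \<otimes>\<^bsub>H\<^esub> A]) =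
        list_prod H (map (\<lambda>x. \<Gamma> x \<otimes>\<^bsub>H\<^esub> A) xs) \<otimes>\<^bsub>H\<^esub> (\<Gamma> x \<otimes>\<^bsub>H\<^esub> A)"
      using snoc.prems \<Gamma>_closed A by (intro H.list_prod_snoc) auto
    also have "\<dots> = \<Gamma> ?P \<otimes>\<^bsub>H\<^esub> (A [^]\<^bsub>H\<^esub> ?k \<otimes>\<^bsub>H\<^esub> \<Gamma> x) \<otimes>\<^bsub>H\<^esub> A"
      using snoc cls by (simp add: H.m_assoc)
    \<comment> \<open>Moving the accumulated power past \<Gamma> x creates exactly the next factor
      of the twisted product.\<close>
    also have "\<dots> = \<Gamma> ?P \<otimes>\<^bsub>H\<^esub> (\<Gamma> ((\<theta> ^^ ?k) x) \<otimes>\<^bsub>H\<^esub> A [^]\<^bsub>H\<^esub> ?k) \<otimes>\<^bsub>H\<^esub> A"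
      using shift[OF cl(1)] by simp
    also have "\<dots> = \<Gamma> (?P \<otimes> (\<theta> ^^ ?k) x) \<otimes>\<^bsub>H\<^esub> A [^]\<^bsub>H\<^esub> Suc ?k"
      using cls hom_mult[OF \<Gamma> cl(2,3)] by (simp add: H.m_assoc)
    finally show ?case
      using snoc.prems by (simp add: twisted_prod_snoc[OF \<theta>])
  qed
qed

text \<open>Of the n factors A collected on the right, n - 1 form \<Gamma>(b), which supplies the
  final \<open>b\<close> of \<open>der\<close>; the remaining one is the A of the translate.\<close>

lemma (in group) nary_hom_of_twisted_hom:
  assumes "group H" "\<theta> \<in> carrier G \<rightarrow> carrier G" "\<Gamma> \<in> hom G H" "A \<in> carrier H"
    and n: "n \<ge> 1" and b: "b \<in> carrier G" "A [^]\<^bsub>H\<^esub> (n - 1) = \<Gamma> b"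
    and "\<And>x. x \<in> carrier G \<Longrightarrow> \<Gamma> (\<theta> x) = A \<otimes>\<^bsub>H\<^esub> \<Gamma> x \<otimes>\<^bsub>H\<^esub> inv\<^bsub>H\<^esub> A"
    and xs: "length xs = n" "set xs \<subseteq> carrier G"
  shows "\<Gamma> (der n G \<theta> b xs) \<otimes>\<^bsub>H\<^esub> A = list_prod H (map (\<lambda>x. \<Gamma> x \<otimes>\<^bsub>H\<^esub> A) xs)"
proof -
  interpret H: group H by fact
  have P: "twisted_prod G \<theta> xs \<in> carrier G"
    using assms by (intro twisted_prod_closed)
  have "A [^]\<^bsub>H\<^esub> n = \<Gamma> b \<otimes>\<^bsub>H\<^esub> A"
    using n b(2) by (cases n) auto
  moreover have "\<Gamma> (twisted_prod G \<theta> xs) \<in> carrier H" "\<Gamma> b \<in> carrier H"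
    using assms(3) P b(1) by (auto simp: hom_def)
  ultimately show ?thesis
    using list_prod_twisted_hom[OF assms(1-4,8) xs(2)] hom_mult[OF assms(3) P b(1)] assms(4)
    by (simp add: xs(1) der_eq_twisted_prod H.m_assoc)
qed

lemma (in group) nary_hom_decompose:
  assumes H: "group H" and n: "n \<ge> 2" and \<theta>: "\<theta> \<in> hom G G" and b: "b \<in> carrier G"
    and \<theta>_pow: "\<And>x. x \<in> carrier G \<Longrightarrow> (\<theta> ^^ (n - 1)) x = b \<otimes> x \<otimes> inv b"
    and \<Lambda>: "\<Lambda> \<in> carrier G \<rightarrow> carrier H"
    and rep: "\<And>xs. length xs = n \<Longrightarrow> set xs \<subseteq> carrier G \<Longrightarrow>
      \<Lambda> (der n G \<theta> b xs) = list_prod H (map \<Lambda> xs)"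
  obtains A \<Gamma> where "A \<in> carrier H" "\<Gamma> \<in> hom G H" "A [^]\<^bsub>H\<^esub> (n - 1) = \<Gamma> b"
    "\<And>x. x \<in> carrier G \<Longrightarrow> \<Lambda> x = \<Gamma> x \<otimes>\<^bsub>H\<^esub> A"
    "\<And>x. x \<in> carrier G \<Longrightarrow> \<Gamma> (\<theta> x) = A \<otimes>\<^bsub>H\<^esub> \<Gamma> x \<otimes>\<^bsub>H\<^esub> inv\<^bsub>H\<^esub> A"
proof -
  interpret H: group H by (rule H)
  \<comment> \<open>k = n - 2 counts the identity entries left when two positions are
    filled.\<close>
  obtain k where k: "n = Suc (Suc k)"
    using n by (metis add_2_eq_Suc le_Suc_ex)
  have \<theta>_closed: "\<theta> \<in> carrier G \<rightarrow> carrier G"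
    using \<theta> by (auto simp: hom_def)
  have \<Lambda>_closed: "\<Lambda> x \<in> carrier H" if "x \<in> carrier G" for x
    using \<Lambda> that by auto
  \<comment> \<open>The only possible choice: a homomorphism \<Gamma> preserves the identity, so
    \<Lambda> x = \<Gamma> x A at x = 1 forces A = \<Lambda> 1.\<close>
  define A where "A = \<Lambda> \<one>"
  define \<Gamma> where "\<Gamma> x = \<Lambda> x \<otimes>\<^bsub>H\<^esub> inv\<^bsub>H\<^esub> A" for x
  have A: "A \<in> carrier H" by (simp add: A_def \<Lambda>_closed)
  have \<Gamma>_closed: "\<Gamma> x \<in> carrier H" if "x \<in> carrier G" for x
    using that A \<Lambda>_closed by (simp add: \<Gamma>_def)
  have \<Lambda>_eq: "\<Lambda> x = \<Gamma> x \<otimes>\<^bsub>H\<^esub> A" if "x \<in> carrier G" for x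
    using that A \<Lambda>_closed by (simp add: \<Gamma>_def H.m_assoc)
  \<comment> \<open>The last argument is hit by \<theta>^(n-1), which is conjugation by b, and the
    final b of \<open>der\<close> cancels the inverse: x (b y b^-1) b = x b y.\<close>
  have \<Lambda>_xby: "\<Lambda> (x \<otimes> b \<otimes> y) = \<Lambda> x \<otimes>\<^bsub>H\<^esub> A [^]\<^bsub>H\<^esub> k \<otimes>\<^bsub>H\<^esub> \<Lambda> y"
    if x: "x \<in> carrier G" and y: "y \<in> carrier G" for x y
  proof -
    let ?xs = "([x] @ replicate k \<one>) @ [y]"
    have "twisted_prod G \<theta> ?xs = twisted_prod G \<theta> [x] \<otimes> (\<theta> ^^ (n - 1)) y"
      using x y \<theta> by (subst twisted_prod_snoc[OF \<theta>_closed])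
        (auto simp: twisted_prod_append_ones k simp del: append_Cons append_Nil)
    then have "der n G \<theta> b ?xs = x \<otimes> b \<otimes> y"
      using x y b \<theta>_pow
      by (simp add: der_eq_twisted_prod k m_assoc twisted_prod_def list_prod_def)
    moreover have "list_prod H (map \<Lambda> ?xs) = \<Lambda> x \<otimes>\<^bsub>H\<^esub> A [^]\<^bsub>H\<^esub> k \<otimes>\<^bsub>H\<^esub> \<Lambda> y"
    proof -
      have "list_prod H (([\<Lambda> x] @ replicate k A) @ [\<Lambda> y]) =
          list_prod H ([\<Lambda> x] @ replicate k A) \<otimes>\<^bsub>H\<^esub> \<Lambda> y"
        using x y A \<Lambda>_closed by (intro H.list_prod_snoc) auto
      also have "list_prod H ([\<Lambda> x] @ replicate k A) = list_prod H [\<Lambda> x] \<otimes>\<^bsub>H\<^esub> A [^]\<^bsub>H\<^esub> k"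
        using x A \<Lambda>_closed by (intro H.list_prod_append_replicate) auto
      finally show ?thesis
        using x \<Lambda>_closed by (simp add: list_prod_def A_def)
    qed
    moreover have "length ?xs = n" "set ?xs \<subseteq> carrier G"
      using x y k by auto
    ultimately show ?thesis using rep[of ?xs] by simp
  qed
  \<comment> \<open>The second position is the one that receives \<theta> exactly once; for n = 2
    the padding is empty.\<close>
  have \<Lambda>_\<theta>: "\<Lambda> (\<theta> x \<otimes> b) = A \<otimes>\<^bsub>H\<^esub> \<Lambda> x \<otimes>\<^bsub>H\<^esub> A [^]\<^bsub>H\<^esub> k" if x: "x \<in> carrier G" for x
  proof -
    let ?xs = "[\<one>, x] @ replicate k \<one>"
    have "twisted_prod G \<theta> ?xs = twisted_prod G \<theta> [\<one>, x]"
      using x by (intro twisted_prod_append_ones[OF \<theta>]) auto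
    then have "der n G \<theta> b ?xs = \<theta> x \<otimes> b"
      using x b \<theta>_closed k
      by (simp add: der_eq_twisted_prod twisted_prod_def list_prod_def Pi_iff)
    moreover have "list_prod H (map \<Lambda> ?xs) = A \<otimes>\<^bsub>H\<^esub> \<Lambda> x \<otimes>\<^bsub>H\<^esub> A [^]\<^bsub>H\<^esub> k"
      using x A \<Lambda>_closed H.list_prod_append_replicate[of "[A, \<Lambda> x]" A k]
      by (simp add: list_prod_def A_def)
    moreover have "length ?xs = n" "set ?xs \<subseteq> carrier G"
      using x k by auto
    ultimately show ?thesis using rep[of ?xs] by simp
  qed
  have \<Lambda>_mult: "\<Lambda> (x \<otimes> y) = \<Lambda> x \<otimes>\<^bsub>H\<^esub> inv\<^bsub>H\<^esub> A \<otimes>\<^bsub>H\<^esub> \<Lambda> y"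
    if x: "x \<in> carrier G" and y: "y \<in> carrier G" for x y
  proof -
    let ?z = "inv b \<otimes> y"
    have z: "?z \<in> carrier G" "\<Lambda> ?z \<in> carrier H"
      using y b \<Lambda>_closed by auto
    have "b \<otimes> ?z = y"
      using y b by (simp flip: m_assoc)
    \<comment> \<open>Substituting b^-1 y in \<open>\<Lambda>_xby\<close> removes b. The cases of
      first argument 1 and x share the factor A^k \<Lambda>(b^-1 y); eliminating it gives the
      product rule.\<close>
    then have "\<Lambda> y = A \<otimes>\<^bsub>H\<^esub> (A [^]\<^bsub>H\<^esub> k \<otimes>\<^bsub>H\<^esub> \<Lambda> ?z)"
      "\<Lambda> (x \<otimes> y) = \<Lambda> x \<otimes>\<^bsub>H\<^esub> (A [^]\<^bsub>H\<^esub> k \<otimes>\<^bsub>H\<^esub> \<Lambda> ?z)"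
      using \<Lambda>_xby[OF one_closed z(1)] \<Lambda>_xby[OF x z(1)] A x y b z \<Lambda>_closed
      by (simp_all add: m_assoc H.m_assoc flip: A_def)
    then show ?thesis
      using A x z \<Lambda>_closed by (simp add: H.m_assoc flip: H.m_assoc[of "inv\<^bsub>H\<^esub> A" A])
  qed
  have \<Gamma>_hom: "\<Gamma> \<in> hom G H"
    using A \<Lambda>_closed \<Gamma>_closed by (auto simp: hom_def \<Lambda>_mult H.m_assoc) (simp add: \<Gamma>_def \<Lambda>_mult H.m_assoc)
  \<comment> \<open>At x = y = 1, \<open>\<Lambda>_xby\<close> reads \<Lambda> b = A A^k A; one A
    cancels on the right and k + 1 = n - 1 factors remain.\<close>
  have \<Gamma>_b: "A [^]\<^bsub>H\<^esub> Suc k = \<Gamma> b"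
    unfolding H.nat_pow_Suc2[OF A] using \<Lambda>_xby[of \<one> \<one>] A b
    by (simp add: \<Gamma>_def H.m_assoc flip: A_def)
  have "\<Gamma> (\<theta> x) = A \<otimes>\<^bsub>H\<^esub> \<Gamma> x \<otimes>\<^bsub>H\<^esub> inv\<^bsub>H\<^esub> A" if x: "x \<in> carrier G" for x
  proof -
    have \<theta>x: "\<theta> x \<in> carrier G" using \<theta>_closed x by auto
    \<comment> \<open>A commutes with its power \<Gamma> b. Hence \<Gamma>(\<theta> x) A A^(k+1) =
      \<Gamma>(\<theta> x) \<Gamma>(b) A = \<Lambda>(\<theta> x b), which
      \<open>\<Lambda>_\<theta>\<close> computes in a second way; cancelling A^(k+1) leaves the
      twist relation.\<close>
    have "A \<otimes>\<^bsub>H\<^esub> A [^]\<^bsub>H\<^esub> Suc k = \<Gamma> b \<otimes>\<^bsub>H\<^esub> A"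
      unfolding \<Gamma>_b[symmetric] H.nat_pow_Suc2[OF A, symmetric] by (rule H.nat_pow_Suc)
    then have "\<Gamma> (\<theta> x) \<otimes>\<^bsub>H\<^esub> A \<otimes>\<^bsub>H\<^esub> A [^]\<^bsub>H\<^esub> Suc k = \<Lambda> (\<theta> x \<otimes> b)"
      using \<theta>x A b \<Gamma>_closed hom_mult[OF \<Gamma>_hom \<theta>x b]
      by (simp add: \<Lambda>_eq H.m_assoc del: H.nat_pow_Suc)
    also have "\<dots> = A \<otimes>\<^bsub>H\<^esub> \<Gamma> x \<otimes>\<^bsub>H\<^esub> A [^]\<^bsub>H\<^esub> Suc k"
      unfolding \<Lambda>_\<theta>[OF x] H.nat_pow_Suc2[OF A]
      using x A \<Gamma>_closed by (simp add: \<Lambda>_eq H.m_assoc)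
    finally have "\<Gamma> (\<theta> x) \<otimes>\<^bsub>H\<^esub> A = A \<otimes>\<^bsub>H\<^esub> \<Gamma> x"
      by (rule iffD1[OF H.right_cancel, rotated 3]) (use A x \<theta>x \<Gamma>_closed in auto)
    then show ?thesis
      using A x \<theta>x \<Gamma>_closed by (metis H.inv_solve_right H.m_closed)
  qed
  then show ?thesis
    using that[OF A \<Gamma>_hom _ \<Lambda>_eq] \<Gamma>_b k by simp
qed

theorem theorem4p1:
  fixes n m :: nat and G :: "('a, 'e) monoid_scheme" (structure)
    and \<theta> :: "'a \<Rightarrow> 'a" and b :: 'a
  assumes "n \<ge> 2" and "m \<ge> 1" and "group G"
    and "\<theta> \<in> iso G G" and "b \<in> carrier G" and "\<theta> b = b"
    and "\<forall>x \<in> carrier G. (\<theta> ^^ (n - 1)) x = b \<otimes> x \<otimes> inv b"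
  shows "(\<forall>\<Lambda>. nary_representation n (carrier G) (der n G \<theta> b) m \<Lambda> \<longrightarrow>
            (\<exists>A \<in> carrier (GL m). \<exists>\<Gamma> \<in> hom G (GL m).
               (\<forall>x \<in> carrier G. \<Lambda> x = (R_map m A \<circ> \<Gamma>) x) \<and>
               A [^]\<^bsub>GL m\<^esub> (n - 1) = \<Gamma> b \<and>
               (\<forall>x \<in> carrier G. (\<Gamma> \<circ> \<theta>) x = (I_inv_map m A \<circ> \<Gamma>) x)))
       \<and> (\<forall>A \<in> carrier (GL m). \<forall>\<Gamma> \<in> hom G (GL m).
            A [^]\<^bsub>GL m\<^esub> (n - 1) = \<Gamma> b \<and>
            (\<forall>x \<in> carrier G. (\<Gamma> \<circ> \<theta>) x = (I_inv_map m A \<circ> \<Gamma>) x) \<longrightarrow>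
            nary_representation n (carrier G) (der n G \<theta> b) m (R_map m A \<circ> \<Gamma>))"
proof (intro conjI allI impI ballI)
  interpret group G by fact
  have \<theta>: "\<theta> \<in> hom G G" using assms(4) by (simp add: iso_def)
  show "\<exists>A \<in> carrier (GL m). \<exists>\<Gamma> \<in> hom G (GL m).
      (\<forall>x \<in> carrier G. \<Lambda> x = (R_map m A \<circ> \<Gamma>) x) \<and>
      A [^]\<^bsub>GL m\<^esub> (n - 1) = \<Gamma> b \<and>
      (\<forall>x \<in> carrier G. (\<Gamma> \<circ> \<theta>) x = (I_inv_map m A \<circ> \<Gamma>) x)"
    if "nary_representation n (carrier G) (der n G \<theta> b) m \<Lambda>" for \<Lambda>
  proof -
    have \<Lambda>: "\<Lambda> \<in> carrier G \<rightarrow> carrier (GL m)"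
      "\<And>xs. length xs = n \<Longrightarrow> set xs \<subseteq> carrier G \<Longrightarrow>
        \<Lambda> (der n G \<theta> b xs) = list_prod (GL m) (map \<Lambda> xs)"
      using that by (auto simp: nary_representation_def)
    obtain A \<Gamma> where "A \<in> carrier (GL m)" "\<Gamma> \<in> hom G (GL m)" "A [^]\<^bsub>GL m\<^esub> (n - 1) = \<Gamma> b"
      "\<And>x. x \<in> carrier G \<Longrightarrow> \<Lambda> x = \<Gamma> x \<otimes>\<^bsub>GL m\<^esub> A"
      "\<And>x. x \<in> carrier G \<Longrightarrow> \<Gamma> (\<theta> x) = A \<otimes>\<^bsub>GL m\<^esub> \<Gamma> x \<otimes>\<^bsub>GL m\<^esub> inv\<^bsub>GL m\<^esub> A"
      using nary_hom_decompose[OF group_GL assms(1) \<theta> assms(5) assms(7)[rule_format] \<Lambda>] by metis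
    then show ?thesis
      by (intro bexI[of _ A] bexI[of _ \<Gamma>]) (auto simp: R_map_def I_inv_map_def)
  qed
  show "nary_representation n (carrier G) (der n G \<theta> b) m (R_map m A \<circ> \<Gamma>)"
    if A: "A \<in> carrier (GL m)" and \<Gamma>: "\<Gamma> \<in> hom G (GL m)"
      and *: "A [^]\<^bsub>GL m\<^esub> (n - 1) = \<Gamma> b \<and>
        (\<forall>x \<in> carrier G. (\<Gamma> \<circ> \<theta>) x = (I_inv_map m A \<circ> \<Gamma>) x)" for A \<Gamma>
  proof -
    have "R_map m A \<circ> \<Gamma> = (\<lambda>x. \<Gamma> x \<otimes>\<^bsub>GL m\<^esub> A)"
      by (simp add: fun_eq_iff R_map_def)
    moreover have "\<theta> \<in> carrier G \<rightarrow> carrier G"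
      using \<theta> by (auto simp: hom_def)
    \<comment> \<open>This is the requirement that a representation take values in
      \<open>GL m\<close>; compatibility with the operation comes from
      \<open>nary_hom_of_twisted_hom\<close>.\<close>
    moreover have "\<Gamma> x \<otimes>\<^bsub>GL m\<^esub> A \<in> carrier (GL m)" if "x \<in> carrier G" for x
      using A \<Gamma> that group.is_monoid[OF group_GL]
      by (auto simp: hom_def intro!: monoid.m_closed)
    ultimately show ?thesis
      using nary_hom_of_twisted_hom[OF group_GL _ \<Gamma> A _ assms(5)] * assms(1)
      by (auto simp: nary_representation_def I_inv_map_def)
  qed
qed

end
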